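(* Let $G$ be a bipartite graph with nonempty bipartition $(A,B)$. Then $$\partial(G) + \partial(\bar{G}) \leq 2(2^{|A|} - 1)(2^{|B|} - 1) + 2.$$
   Context: Graphs are finite and simple (undirected, no loops or multiple edges), and $\bar{G}$ denotes the complement of $G$ (on the same vertex set). A subset $S \subseteq V(G)$ is dominating in $G$ if every vertex of $G$ is either in $S$ or adjacent in $G$ to a vertex of $S$. $\partial(G)$ denotes the number of dominating sets of $G$. A graph $G$ is bipartite with nonempty bipartition $(A,B)$ if $V(G)$ is the disjoint union of the nonempty sets $A$ and $B$ and $G$ has no edge with both endpoints in $A$ and no edge with both endpoints in $B$. *)

theory Defs
  imports "Graph_Theory.Pair_Digraph"
begin

text \<open>
  A finite simple graph is a \<open>pair_graph\<close>: a finite vertex set \<open>pverts G\<close> with a symmetric,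
  irreflexive arc relation \<open>parcs G\<close>. Vertices \<open>u\<close> and \<open>v\<close> are adjacent iff
  \<open>(u, v) \<in> parcs G\<close>; each edge is represented by both of its orientations.
\<close>

definition complement_graph :: "'a pair_pre_digraph \<Rightarrow> 'a pair_pre_digraph" where
  "complement_graph G =
     \<lparr> pverts = pverts G,
       parcs = {(u, v). u \<in> pverts G \<and> v \<in> pverts G \<and> u \<noteq> v \<and> (u, v) \<notin> parcs G} \<rparr>"

definition dominating_set :: "'a pair_pre_digraph \<Rightarrow> 'a set \<Rightarrow> bool" where
  "dominating_set G S \<longleftrightarrow>
     S \<subseteq> pverts G \<and> (\<forall>v\<in>pverts G. v \<in> S \<or> (\<exists>s\<in>S. (v, s) \<in> parcs G))"

definition num_dominating_sets :: "'a pair_pre_digraph \<Rightarrow> nat" where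
  "num_dominating_sets G = card {S. dominating_set G S}"

definition nonempty_bipartition :: "'a pair_pre_digraph \<Rightarrow> 'a set \<Rightarrow> 'a set \<Rightarrow> bool" where
  "nonempty_bipartition G A B \<longleftrightarrow>
     A \<noteq> {} \<and> B \<noteq> {} \<and> A \<inter> B = {} \<and> pverts G = A \<union> B \<and>
     (\<forall>(u, v)\<in>parcs G. \<not> (u \<in> A \<and> v \<in> A) \<and> \<not> (u \<in> B \<and> v \<in> B))"

lemma pair_graph_complement_graph:
  assumes "pair_graph G"
  shows "pair_graph (complement_graph G)"
proof -
  interpret G: pair_graph G by fact
  have "parcs (complement_graph G) \<subseteq> pverts G \<times> pverts G"
    by (auto simp: complement_graph_def)
  then have "finite (parcs (complement_graph G))"
    by (rule finite_subset) (simp add: G.pair_finite_verts)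
  then show ?thesis
    by unfold_locales
      (auto simp: complement_graph_def symmetric_def G.pair_finite_verts
        intro!: symI dest: G.arcs_symmetric)
qed

lemma finite_dominating_sets:
  assumes "pair_graph G"
  shows "finite {S. dominating_set G S}"
proof -
  interpret G: pair_graph G by fact
  have "{S. dominating_set G S} \<subseteq> Pow (pverts G)"
    by (auto simp: dominating_set_def)
  then show ?thesis
    by (rule finite_subset) (simp add: G.pair_finite_verts)
qed

end

theory Submission
  imports Defs
begin

text \<open>
  Call a set crossing if it meets both sides of the bipartition; there are
  \<open>(2 ^ card A - 1) * (2 ^ card B - 1)\<close> crossing sets. A dominating set of \<open>G\<close> is crossing or
  equals \<open>A\<close> or \<open>B\<close>, since a vertex of \<open>A\<close> outside a set \<open>S \<subseteq> A\<close> has no neighbour in \<open>S\<close>. In the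
  complement both sides are cliques, so the crossing sets dominate, and a set \<open>S\<close> inside one side
  dominates iff it is nonempty and no vertex of the other side is adjacent in \<open>G\<close> to all of \<open>S\<close>.
  Let \<open>P\<close> and \<open>Q\<close> be the families of such sets inside \<open>A\<close> and \<open>B\<close>, and let \<open>W\<close> be the family of those
  sets that are crossing or equal to \<open>A\<close> or \<open>B\<close> and do not dominate \<open>G\<close>. The bound then amounts to
  \<open>card P + card Q \<le> card W\<close>: each one-sided set without a common neighbour has to be paid for by
  a set that fails to dominate \<open>G\<close>.

  The payment is by complementation. Fix nonadjacent \<open>u0 \<in> A\<close> and \<open>v0 \<in> B\<close>. If \<open>S \<subset> A\<close> has no
  common neighbour, some \<open>u \<in> S\<close> is nonadjacent to \<open>v0\<close>, and then \<open>u\<close> is not dominated by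
  \<open>(A - S) \<union> {v0}\<close>. This is the map \<open>escape\<close>, apart from its value at \<open>A\<close>; it is
  injective, as is its mirror image on \<open>Q\<close>, and the two images can meet only in the pair
  \<open>{u0, v0}\<close>, and only if both \<open>A - {u0}\<close> and \<open>B - {v0}\<close> lack a common neighbour. If this happens for every nonadjacent pair, then any \<open>u1 \<noteq> u0\<close> in \<open>A\<close>
  and \<open>v1 \<noteq> v0\<close> in \<open>B\<close> form a further nondominating set \<open>{u1, v1}\<close>, which makes up for the lost one.
\<close>

section \<open>Crossing sets\<close>

definition crossing :: "'a set \<Rightarrow> 'a set \<Rightarrow> 'a set set" where
  "crossing A B = {X. X \<subseteq> A \<union> B \<and> X \<inter> A \<noteq> {} \<and> X \<inter> B \<noteq> {}}"

lemma crossing_commute: "crossing A B = crossing B A"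
  by (auto simp: crossing_def)

lemma finite_crossing:
  assumes "finite A" "finite B"
  shows "finite (crossing A B)"
  by (rule finite_subset[of _ "Pow (A \<union> B)"]) (use assms in \<open>auto simp: crossing_def\<close>)

lemma card_crossing:
  assumes "finite A" "finite B" "A \<inter> B = {}"
  shows "card (crossing A B) = (2 ^ card A - 1) * (2 ^ card B - 1)"
proof -
  have "bij_betw (\<lambda>X. (X \<inter> A, X \<inter> B)) (crossing A B) ((Pow A - {{}}) \<times> (Pow B - {{}}))"
    by (rule bij_betw_byWitness[where f' = "\<lambda>(S, T). S \<union> T"])
      (use assms(3) in \<open>auto simp: crossing_def\<close>)
  then have "card (crossing A B) = card ((Pow A - {{}}) \<times> (Pow B - {{}}))"
    by (rule bij_betw_same_card)
  also have "\<dots> = (2 ^ card A - 1) * (2 ^ card B - 1)"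
    using assms by (simp add: card_cartesian_product card_Diff_singleton card_Pow)
  finally show ?thesis .
qed

section \<open>Dominating sets of a bipartite graph and of its complement\<close>

definition no_common_neighbour :: "'a pair_pre_digraph \<Rightarrow> 'a set \<Rightarrow> 'a set \<Rightarrow> 'a set set" where
  "no_common_neighbour G A B = {S. S \<subseteq> A \<and> S \<noteq> {} \<and> (\<forall>v\<in>B. \<exists>u\<in>S. (v, u) \<notin> parcs G)}"

definition nondominating :: "'a pair_pre_digraph \<Rightarrow> 'a set \<Rightarrow> 'a set \<Rightarrow> 'a set set" where
  "nondominating G A B = {X \<in> crossing A B \<union> {A, B}. \<not> dominating_set G X}"

lemma nondominating_commute: "nondominating G A B = nondominating G B A"
  by (auto simp: nondominating_def crossing_commute)

lemma finite_no_common_neighbour: "finite A \<Longrightarrow> finite (no_common_neighbour G A B)"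
  by (rule finite_subset[of _ "Pow A"]) (auto simp: no_common_neighbour_def)

lemma no_common_neighbour_mono:
  assumes "S \<in> no_common_neighbour G A B" "S \<subseteq> T" "T \<subseteq> A"
  shows "T \<in> no_common_neighbour G A B"
  using assms unfolding no_common_neighbour_def by blast

locale bipartite_graph =
  fixes G :: "'a pair_pre_digraph" and A B :: "'a set"
  assumes pair_graph: "pair_graph G"
    and bipartition: "nonempty_bipartition G A B"
begin

lemma
  shows A_nonempty: "A \<noteq> {}"
    and B_nonempty: "B \<noteq> {}"
    and disjoint: "A \<inter> B = {}"
    and verts: "pverts G = A \<union> B"
    and no_arc_A: "u \<in> A \<Longrightarrow> v \<in> A \<Longrightarrow> (u, v) \<notin> parcs G"
    and no_arc_B: "u \<in> B \<Longrightarrow> v \<in> B \<Longrightarrow> (u, v) \<notin> parcs G"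
  using bipartition unfolding nonempty_bipartition_def by auto

lemma finite_A: "finite A" and finite_B: "finite B"
proof -
  interpret G: pair_graph G by (rule pair_graph)
  show "finite A" "finite B"
    using G.pair_finite_verts by (auto simp: verts)
qed

lemma arc_sym: "(u, v) \<in> parcs G \<Longrightarrow> (v, u) \<in> parcs G"
proof -
  interpret G: pair_graph G by (rule pair_graph)
  show "(u, v) \<in> parcs G \<Longrightarrow> (v, u) \<in> parcs G"
    by (rule G.arcs_symmetric)
qed

lemma swap: "bipartite_graph G B A"
  by (rule bipartite_graph.intro[OF pair_graph])
    (use bipartition in \<open>auto simp: nonempty_bipartition_def\<close>)

lemma finite_nondominating: "finite (nondominating G A B)"
  by (simp add: nondominating_def finite_crossing finite_A finite_B)

lemma not_dominatingI:
  assumes "x \<in> A \<union> B" "x \<notin> X" "\<And>y. y \<in> X \<Longrightarrow> (x, y) \<notin> parcs G"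
  shows "\<not> dominating_set G X"
  using assms by (auto simp: dominating_set_def verts)

lemma dominating_cases:
  assumes "dominating_set G X"
  shows "X \<in> crossing A B \<union> {A, B}"
proof -
  have sub: "X \<subseteq> A \<union> B"
    using assms by (auto simp: dominating_set_def verts)
  have "X = B" if "X \<inter> A = {}"
  proof -
    have "X \<subseteq> B" using sub that by blast
    moreover have "v \<in> X" if "v \<in> B" for v
      using assms no_arc_B \<open>X \<subseteq> B\<close> that by (fastforce simp: dominating_set_def verts)
    ultimately show ?thesis by blast
  qed
  moreover have "X = A" if "X \<inter> B = {}"
  proof -
    have "X \<subseteq> A" using sub that by blast
    moreover have "v \<in> X" if "v \<in> A" for v
      using assms no_arc_A \<open>X \<subseteq> A\<close> that by (fastforce simp: dominating_set_def verts)
    ultimately show ?thesis by blast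
  qed
  ultimately show ?thesis
    using sub by (auto simp: crossing_def)
qed

lemma complement_dominating_one_side:
  assumes "dominating_set (complement_graph G) X" "X \<inter> B = {}"
  shows "X \<in> no_common_neighbour G A B"
proof -
  have "X \<subseteq> A"
    using assms by (auto simp: dominating_set_def complement_graph_def verts)
  moreover have "\<exists>u\<in>X. (v, u) \<notin> parcs G" if "v \<in> B" for v
    using assms that by (fastforce simp: dominating_set_def complement_graph_def verts)
  ultimately show ?thesis
    using B_nonempty unfolding no_common_neighbour_def by blast
qed

lemma complement_dominating_cases:
  assumes "dominating_set (complement_graph G) X"
  shows "X \<in> crossing A B \<union> no_common_neighbour G A B \<union> no_common_neighbour G B A"
proof -
  have "X \<subseteq> A \<union> B"
    using assms by (auto simp: dominating_set_def complement_graph_def verts)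
  then show ?thesis
    using complement_dominating_one_side[OF assms]
      bipartite_graph.complement_dominating_one_side[OF swap assms]
    by (auto simp: crossing_def)
qed

section \<open>Paying for sets without a common neighbour\<close>

text \<open>
  The complementation \<open>S \<mapsto> (A - S) \<union> {v0}\<close> would send \<open>A\<close> itself to the set \<open>{v0}\<close>, which is
  in general neither crossing nor a whole side. So \<open>A\<close> needs another image, and the natural
  candidate is the one that \<open>{u0}\<close> would have. That image is free precisely if \<open>u0\<close> has a
  neighbour; if \<open>u0\<close> is isolated, the set \<open>B\<close> does not dominate \<open>u0\<close> and takes its place.
\<close>

definition escape :: "'a \<Rightarrow> 'a \<Rightarrow> 'a set \<Rightarrow> 'a set" where
  "escape u0 v0 S =
     (if S \<noteq> A then insert v0 (A - S)
      else if {u0} \<in> no_common_neighbour G A B then B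
      else insert v0 (A - {u0}))"

context
  fixes u0 v0
  assumes u0: "u0 \<in> A" and v0: "v0 \<in> B" and nonadjacent: "(v0, u0) \<notin> parcs G"
begin

lemma not_dominating_complement:
  assumes "S \<subseteq> A" "u \<in> S" "(v0, u) \<notin> parcs G"
  shows "\<not> dominating_set G (insert v0 (A - S))"
proof (rule not_dominatingI[of u])
  show "u \<in> A \<union> B" "u \<notin> insert v0 (A - S)"
    using assms v0 disjoint by auto
  show "(u, y) \<notin> parcs G" if "y \<in> insert v0 (A - S)" for y
    using that assms no_arc_A arc_sym by auto
qed

lemma escape_nondominating:
  assumes S: "S \<in> no_common_neighbour G A B"
  shows "escape u0 v0 S \<in> nondominating G A B"
proof -
  have "S \<subseteq> A" using S by (simp add: no_common_neighbour_def)
  consider "S \<noteq> A" | "S = A" "{u0} \<in> no_common_neighbour G A B"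
    | "S = A" "{u0} \<notin> no_common_neighbour G A B" by blast
  then show ?thesis
  proof cases
    case 1
    obtain u where "u \<in> S" "(v0, u) \<notin> parcs G"
      using S v0 by (auto simp: no_common_neighbour_def)
    then have "\<not> dominating_set G (insert v0 (A - S))"
      using not_dominating_complement \<open>S \<subseteq> A\<close> by blast
    then show ?thesis
      using 1 \<open>S \<subseteq> A\<close> v0 by (auto simp: escape_def nondominating_def crossing_def)
  next
    case 2
    have "\<not> dominating_set G B"
    proof (rule not_dominatingI[of u0])
      show "u0 \<in> A \<union> B" "u0 \<notin> B"
        using u0 disjoint by auto
      show "(u0, y) \<notin> parcs G" if "y \<in> B" for y
        using that 2(2) arc_sym by (auto simp: no_common_neighbour_def)
    qed
    then show ?thesis
      using 2 by (simp add: escape_def nondominating_def)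
  next
    case 3
    then have "A \<noteq> {u0}" using S by auto
    then obtain a where "a \<in> A" "a \<noteq> u0" using u0 by blast
    then have "insert v0 (A - {u0}) \<in> crossing A B"
      using v0 by (auto simp: crossing_def)
    moreover have "\<not> dominating_set G (insert v0 (A - {u0}))"
      using u0 nonadjacent by (intro not_dominating_complement) auto
    ultimately show ?thesis
      using 3 by (simp add: escape_def nondominating_def)
  qed
qed

lemma escape_cases:
  "escape u0 v0 S = B \<or> escape u0 v0 S \<inter> B = {v0}"
  using v0 disjoint by (auto simp: escape_def)

lemma Diff_escape:
  assumes "S \<subseteq> A" "S \<noteq> A"
  shows "A - escape u0 v0 S = S"
proof -
  have "v0 \<notin> A" using v0 disjoint by blast
  then have "A - insert v0 (A - S) = S" using assms(1) by blast
  then show ?thesis using assms(2) by (simp add: escape_def)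
qed

lemma Diff_escape_whole:
  "A - escape u0 v0 A = (if {u0} \<in> no_common_neighbour G A B then A else {u0})"
proof -
  have "A - B = A" "A - insert v0 (A - {u0}) = {u0}"
    using u0 v0 disjoint by blast+
  then show ?thesis by (simp add: escape_def)
qed

text \<open>
  A proper subset \<open>S\<close> of \<open>A\<close> can be read off from its image as \<open>A - escape u0 v0 S\<close>. For \<open>A\<close>
  itself this recipe returns \<open>A\<close> or \<open>{u0}\<close>, and \<open>{u0}\<close> only when it is not in the domain, so that
  no proper subset shares the image of \<open>A\<close>.
\<close>

lemma inj_on_escape: "inj_on (escape u0 v0) (no_common_neighbour G A B)"
proof -
  have whole: "S = A"
    if S: "S \<in> no_common_neighbour G A B" and eq: "escape u0 v0 S = escape u0 v0 A" for S
  proof (rule ccontr)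
    assume "S \<noteq> A"
    moreover have "S \<subseteq> A" using S by (simp add: no_common_neighbour_def)
    ultimately have "S = (if {u0} \<in> no_common_neighbour G A B then A else {u0})"
      using Diff_escape Diff_escape_whole eq by metis
    then show False
      using S \<open>S \<noteq> A\<close> by (simp split: if_splits)
  qed
  show ?thesis
  proof (rule inj_onI)
    fix S T
    assume S: "S \<in> no_common_neighbour G A B" and T: "T \<in> no_common_neighbour G A B"
      and eq: "escape u0 v0 S = escape u0 v0 T"
    have sub: "S \<subseteq> A" "T \<subseteq> A"
      using S T by (simp_all add: no_common_neighbour_def)
    show "S = T"
      using whole[OF S] whole[OF T] Diff_escape[OF sub(1)] Diff_escape[OF sub(2)] eq
      by metis
  qed
qed

lemma escape_eq_pairD:
  assumes "S \<in> no_common_neighbour G A B" "escape u0 v0 S = {u0, v0}"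
  shows "A - {u0} \<in> no_common_neighbour G A B"
proof -
  have "u0 \<notin> B" "u0 \<noteq> v0" "v0 \<notin> A"
    using u0 v0 disjoint by blast+
  then have "u0 \<notin> escape u0 v0 A"
    by (simp add: escape_def)
  then have "S \<noteq> A" using assms(2) by auto
  moreover have "S \<subseteq> A"
    using assms(1) by (simp add: no_common_neighbour_def)
  ultimately have "A - {u0, v0} = S"
    using Diff_escape assms(2) by metis
  moreover have "A - {u0, v0} = A - {u0}"
    using \<open>v0 \<notin> A\<close> by blast
  ultimately show ?thesis using assms(1) by simp
qed

end

text \<open>
  If a set lies in both images, its trace on \<open>B\<close> is \<open>{v0}\<close> and its trace on \<open>A\<close> is \<open>{u0}\<close>: the two
  exceptional values \<open>A\<close> and \<open>B\<close> are never shared, as every other value is crossing.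
\<close>

lemma escape_images_inter:
  assumes "u0 \<in> A" "v0 \<in> B" "(v0, u0) \<notin> parcs G"
  shows "escape u0 v0 ` no_common_neighbour G A B \<inter>
           bipartite_graph.escape G B A v0 u0 ` no_common_neighbour G B A \<subseteq> {{u0, v0}}"
proof
  interpret swapped: bipartite_graph G B A by (rule swap)
  have assms': "v0 \<in> B" "u0 \<in> A" "(u0, v0) \<notin> parcs G"
    using assms arc_sym by blast+
  fix X
  assume "X \<in> escape u0 v0 ` no_common_neighbour G A B \<inter>
    swapped.escape v0 u0 ` no_common_neighbour G B A"
  then obtain S T where S: "S \<in> no_common_neighbour G A B" "X = escape u0 v0 S"
    and T: "X = swapped.escape v0 u0 T" by blast
  have "X = B \<or> X \<inter> B = {v0}"
    using escape_cases[OF assms] S(2) by simp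
  moreover have "X = A \<or> X \<inter> A = {u0}"
    using swapped.escape_cases[OF assms'] T by simp
  moreover have "B \<inter> A = {}" "A \<inter> B = {}" "A \<noteq> B"
    using disjoint A_nonempty by auto
  ultimately have traces: "X \<inter> B = {v0}" "X \<inter> A = {u0}"
    by (metis insert_not_empty)+
  have "X \<subseteq> A \<union> B"
    using escape_nondominating[OF assms S(1)] S(2) by (auto simp: nondominating_def crossing_def)
  then have "X = (X \<inter> A) \<union> (X \<inter> B)" by blast
  then have "X = {u0, v0}" unfolding traces by (simp add: insert_commute)
  then show "X \<in> {{u0, v0}}" by simp
qed

text \<open>
  The pair does not dominate as soon as \<open>v1\<close> has a nonneighbour in \<open>A\<close> other than \<open>u1\<close>.
  It has some nonneighbour in \<open>A\<close> because \<open>A\<close> has no common neighbour; if that is \<open>u1\<close> itself, then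
  the hypothesis, applied to the nonadjacent pair of \<open>u1\<close> and \<open>v1\<close>, provides a second one.
\<close>

lemma pair_nondominating:
  assumes A: "A \<in> no_common_neighbour G A B"
    and remove: "\<And>u v. u \<in> A \<Longrightarrow> v \<in> B \<Longrightarrow> (v, u) \<notin> parcs G \<Longrightarrow>
      A - {u} \<in> no_common_neighbour G A B"
    and "u1 \<in> A" "v1 \<in> B"
  shows "{u1, v1} \<in> nondominating G A B"
proof -
  obtain u where u: "u \<in> A" "u \<noteq> u1" "(v1, u) \<notin> parcs G"
  proof (cases "(v1, u1) \<in> parcs G")
    case True
    then show ?thesis
      using A assms(4) that by (auto simp: no_common_neighbour_def)
  next
    case False
    then show ?thesis
      using remove[OF assms(3,4)] assms(4) that by (auto simp: no_common_neighbour_def)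
  qed
  have "\<not> dominating_set G {u1, v1}"
  proof (rule not_dominatingI[of u])
    show "u \<in> A \<union> B" "u \<notin> {u1, v1}"
      using u assms(4) disjoint by auto
    show "(u, y) \<notin> parcs G" if "y \<in> {u1, v1}" for y
      using that u assms(3) no_arc_A arc_sym by auto
  qed
  then show ?thesis
    using assms(3,4) by (auto simp: nondominating_def crossing_def)
qed

text \<open>
  If \<open>A\<close> and \<open>B\<close> are completely joined, both families are empty. Otherwise any nonadjacent pair
  gives two injections into the nondominating sets. Either some such pair makes their images
  disjoint, or every such pair meets the hypothesis of \<open>pair_nondominating\<close>, which then supplies
  one set outside both images to compensate for the single shared one.
\<close>

lemma card_no_common_neighbour_le:
  "card (no_common_neighbour G A B) + card (no_common_neighbour G B A)
    \<le> card (nondominating G A B)"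
proof (cases "\<exists>u0\<in>A. \<exists>v0\<in>B. (v0, u0) \<notin> parcs G")
  case False
  then have "no_common_neighbour G A B = {}" "no_common_neighbour G B A = {}"
    using A_nonempty B_nonempty arc_sym unfolding no_common_neighbour_def by blast+
  then show ?thesis by simp
next
  case True
  interpret swapped: bipartite_graph G B A by (rule swap)
  let ?P = "no_common_neighbour G A B" and ?Q = "no_common_neighbour G B A"
  let ?W = "nondominating G A B"
  let ?I = "\<lambda>u0 v0. escape u0 v0 ` ?P" and ?J = "\<lambda>u0 v0. swapped.escape v0 u0 ` ?Q"
  have fin: "finite (?I u0 v0)" "finite (?J u0 v0)" for u0 v0
    by (simp_all add: finite_no_common_neighbour finite_A finite_B)
  have images: "card (?I u0 v0) = card ?P" "card (?J u0 v0) = card ?Q"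
    "?I u0 v0 \<subseteq> ?W" "?J u0 v0 \<subseteq> ?W"
    if pair: "u0 \<in> A" "v0 \<in> B" "(v0, u0) \<notin> parcs G" for u0 v0
  proof -
    have pair': "v0 \<in> B" "u0 \<in> A" "(u0, v0) \<notin> parcs G"
      using pair arc_sym by blast+
    show "card (?I u0 v0) = card ?P" "card (?J u0 v0) = card ?Q"
      by (simp_all add: card_image inj_on_escape[OF pair] swapped.inj_on_escape[OF pair'])
    show "?I u0 v0 \<subseteq> ?W" "?J u0 v0 \<subseteq> ?W"
      using escape_nondominating[OF pair] swapped.escape_nondominating[OF pair']
      by (auto simp: nondominating_commute[of G B A])
  qed
  show ?thesis
  proof (cases "\<exists>u0\<in>A. \<exists>v0\<in>B. (v0, u0) \<notin> parcs G \<and> \<not> (A - {u0} \<in> ?P \<and> B - {v0} \<in> ?Q)")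
    case True
    then obtain u0 v0 where pair: "u0 \<in> A" "v0 \<in> B" "(v0, u0) \<notin> parcs G"
      and no_collision: "\<not> (A - {u0} \<in> ?P \<and> B - {v0} \<in> ?Q)" by blast
    have pair': "v0 \<in> B" "u0 \<in> A" "(u0, v0) \<notin> parcs G"
      using pair arc_sym by blast+
    have "{u0, v0} \<notin> ?I u0 v0 \<inter> ?J u0 v0"
    proof
      assume "{u0, v0} \<in> ?I u0 v0 \<inter> ?J u0 v0"
      then obtain S T where ST: "S \<in> ?P" "escape u0 v0 S = {u0, v0}"
        "T \<in> ?Q" "swapped.escape v0 u0 T = {v0, u0}" by (auto simp: insert_commute)
      show False
        using escape_eq_pairD[OF pair ST(1,2)] swapped.escape_eq_pairD[OF pair' ST(3,4)]
          no_collision by blast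
    qed
    then have "?I u0 v0 \<inter> ?J u0 v0 = {}"
      using escape_images_inter[OF pair] by blast
    then have "card ?P + card ?Q = card (?I u0 v0 \<union> ?J u0 v0)"
      using images[OF pair] fin by (simp add: card_Un_disjoint)
    also have "\<dots> \<le> card ?W"
      using images[OF pair] by (intro card_mono finite_nondominating) blast
    finally show ?thesis .
  next
    case False
    obtain u0 v0 where pair: "u0 \<in> A" "v0 \<in> B" "(v0, u0) \<notin> parcs G"
      using True by blast
    have pair': "v0 \<in> B" "u0 \<in> A" "(u0, v0) \<notin> parcs G"
      using pair arc_sym by blast+
    have both: "A - {u0} \<in> ?P" "B - {v0} \<in> ?Q"
      using False pair by blast+
    then have "A \<in> ?P"
      using no_common_neighbour_mono by blast
    \<comment> \<open>Both differences are nonempty, being members of \<open>?P\<close> and \<open>?Q\<close>.\<close>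
    obtain u1 v1 where u1: "u1 \<in> A" "u1 \<noteq> u0" and v1: "v1 \<in> B" "v1 \<noteq> v0"
      using both by (auto simp: no_common_neighbour_def)
    have extra: "{u1, v1} \<in> ?W"
      using \<open>A \<in> ?P\<close> False u1 v1 by (intro pair_nondominating) blast+
    have "u1 \<notin> B" "v1 \<notin> A"
      using u1 v1 disjoint by blast+
    then have "{u1, v1} \<noteq> B" "{u1, v1} \<inter> B \<noteq> {v0}"
        "{u1, v1} \<noteq> A" "{u1, v1} \<inter> A \<noteq> {u0}"
      using u1 v1 by auto
    moreover have "X = B \<or> X \<inter> B = {v0}" if "X \<in> ?I u0 v0" for X
      using that escape_cases[OF pair] by auto
    moreover have "X = A \<or> X \<inter> A = {u0}" if "X \<in> ?J u0 v0" for X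
      using that swapped.escape_cases[OF pair'] by auto
    ultimately have new: "{u1, v1} \<notin> ?I u0 v0 \<union> ?J u0 v0"
      by (metis UnE)
    have "card ?P + card ?Q = card (?I u0 v0 \<union> ?J u0 v0) + card (?I u0 v0 \<inter> ?J u0 v0)"
      using images[OF pair] fin card_Un_Int by metis
    also have "card (?I u0 v0 \<inter> ?J u0 v0) \<le> 1"
      using card_mono[OF _ escape_images_inter[OF pair]] by simp
    also have "card (?I u0 v0 \<union> ?J u0 v0) + 1 = card (insert {u1, v1} (?I u0 v0 \<union> ?J u0 v0))"
      using new fin by simp
    also have "\<dots> \<le> card ?W"
      using images[OF pair] extra by (intro card_mono finite_nondominating) blast
    finally show ?thesis by simp
  qed
qed

lemma num_dominating_sets_le:
  "num_dominating_sets G + card (nondominating G A B) \<le> card (crossing A B) + 2"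
proof -
  let ?D = "{X. dominating_set G X}" and ?W = "nondominating G A B"
  have "num_dominating_sets G + card ?W = card (?D \<union> ?W)"
    unfolding num_dominating_sets_def
    by (rule card_Un_disjoint[symmetric])
      (use finite_nondominating finite_dominating_sets[OF pair_graph] in
        \<open>auto simp: nondominating_def\<close>)
  also have "\<dots> \<le> card (crossing A B \<union> {A, B})"
    using dominating_cases
    by (intro card_mono) (auto simp: nondominating_def finite_crossing finite_A finite_B)
  also have "\<dots> \<le> card (crossing A B) + card {A, B}"
    by (rule card_Un_le)
  also have "card {A, B} \<le> 2"
    by (simp add: card_insert_if)
  finally show ?thesis by simp
qed

lemma num_dominating_sets_complement_le:
  "num_dominating_sets (complement_graph G)
    \<le> card (crossing A B) + card (no_common_neighbour G A B) + card (no_common_neighbour G B A)"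
proof -
  let ?C = "crossing A B" and ?P = "no_common_neighbour G A B" and ?Q = "no_common_neighbour G B A"
  have "num_dominating_sets (complement_graph G) \<le> card (?C \<union> ?P \<union> ?Q)"
    unfolding num_dominating_sets_def using complement_dominating_cases
    by (intro card_mono)
      (auto simp: finite_crossing finite_no_common_neighbour finite_A finite_B)
  also have "\<dots> \<le> card ?C + card ?P + card ?Q"
    by (meson add_le_mono1 card_Un_le order_trans)
  finally show ?thesis .
qed

end

section \<open>The bound\<close>

theorem theorem1p3:
  fixes G :: "'a pair_pre_digraph" and A B :: "'a set"
  assumes "pair_graph G"
    and "nonempty_bipartition G A B"
  shows "int (num_dominating_sets G) + int (num_dominating_sets (complement_graph G))
    \<le> 2 * (2 ^ card A - 1) * (2 ^ card B - 1) + 2"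
proof -
  interpret bipartite_graph G A B
    by (rule bipartite_graph.intro[OF assms])
  have "num_dominating_sets G + num_dominating_sets (complement_graph G)
      \<le> 2 * card (crossing A B) + 2"
    using num_dominating_sets_le num_dominating_sets_complement_le card_no_common_neighbour_le
    by linarith
  moreover have "int (card (crossing A B)) = (2 ^ card A - 1) * (2 ^ card B - 1)"
    by (simp add: card_crossing finite_A finite_B disjoint of_nat_diff)
  ultimately show ?thesis by linarith
qed

end
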